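(* Let $J$ be the theory over the signature $( *,\to,e)$ of arities $(2,2,0)$ with axioms $x\to x\approx e$, $e\to x\approx x$, and $((x\to y)\to y)*(((x\to y)\to y)\to x)\approx x$. Write $x\le y$ for the equation $x\to y\approx e$ and let $\theta(x_0,x_1,x_2)=(x_1\to x_0)*x_2$, $\theta_1(x,y)=x\to y$, $\theta_2(x,y)=((x\to y)\to y)\to x$. Then: \begin{enumerate} \item $J$ is semi-abelian: $J\vdash e\to e\approx e$ and $J\vdash e*e\approx e$ (pointed with respect to $e$); $J\vdash x*e\approx x$; and $J\vdash\theta_1(x,x)\approx e$, $J\vdash\theta_2(x,x)\approx e$, $J\vdash\theta(y,\theta_1(x,y),\theta_2(x,y))\approx x$. \item In every $J$-algebra the relation $a\le b$ (i.e. $a\to b=e$) is reflexive and anti-symmetric, and $J\vdash x\le y\Rightarrow (x\to y)\to y\approx y$ (i.e. in every $J$-algebra, $a\to b=e$ implies $(a\to b)\to b=b$). \end{enumerate}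
   Context: $J\vdash\phi$ means the equation $\phi$ is derivable from $J$ by equational logic, equivalently holds in all $J$-algebras. A theory is semi-abelian if it is pointed (there is a constant $c$ with $f(c,\dots,c)\approx c$ provable for every operation symbol $f$) and protomodular (there exist terms $\theta(x_0,\dots,x_n)$ and binary $\theta_1,\dots,\theta_n$ with $\theta_i(x,x)$ provably equal to constant terms and $\theta(y,\theta_1(x,y),\dots,\theta_n(x,y))\approx x$ provable). *)

theory Defs
  imports Main
begin

datatype (funs: 'f, vars: 'v) trm = Var 'v | Fun 'f "('f, 'v) trm list"

fun wf_trm :: "('f \<Rightarrow> nat) \<Rightarrow> ('f, 'v) trm \<Rightarrow> bool" where
  "wf_trm ar (Var x) = True"
| "wf_trm ar (Fun f ts) = (length ts = ar f \<and> (\<forall>t \<in> set ts. wf_trm ar t))"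

fun subst :: "('v \<Rightarrow> ('f, 'w) trm) \<Rightarrow> ('f, 'v) trm \<Rightarrow> ('f, 'w) trm" where
  "subst \<sigma> (Var x) = \<sigma> x"
| "subst \<sigma> (Fun f ts) = Fun f (map (subst \<sigma>) ts)"

fun eval :: "('f \<Rightarrow> 'a list \<Rightarrow> 'a) \<Rightarrow> ('v \<Rightarrow> 'a) \<Rightarrow> ('f, 'v) trm \<Rightarrow> 'a" where
  "eval I \<alpha> (Var x) = \<alpha> x"
| "eval I \<alpha> (Fun f ts) = I f (map (eval I \<alpha>) ts)"

text \<open>A theory over the signature \<open>ar\<close> is a set of equations, an equation \<open>s \<approx> t\<close>
  being the pair \<open>(s, t)\<close>; the variables are the natural numbers.\<close>

type_synonym 'f eqs = "(('f, nat) trm \<times> ('f, nat) trm) set"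

definition is_theory :: "('f \<Rightarrow> nat) \<Rightarrow> 'f eqs \<Rightarrow> bool" where
  "is_theory ar T \<longleftrightarrow> (\<forall>(s, t) \<in> T. wf_trm ar s \<and> wf_trm ar t)"

inductive derivable :: "('f \<Rightarrow> nat) \<Rightarrow> 'f eqs \<Rightarrow> ('f, nat) trm \<Rightarrow> ('f, nat) trm \<Rightarrow> bool"
  for ar T where
  ax: "(s, t) \<in> T \<Longrightarrow> derivable ar T s t"
| refl: "wf_trm ar s \<Longrightarrow> derivable ar T s s"
| sym: "derivable ar T s t \<Longrightarrow> derivable ar T t s"
| trans: "derivable ar T s t \<Longrightarrow> derivable ar T t u \<Longrightarrow> derivable ar T s u"
| cong: "length ss = ar f \<Longrightarrow> list_all2 (derivable ar T) ss ts
    \<Longrightarrow> derivable ar T (Fun f ss) (Fun f ts)"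
| inst: "derivable ar T s t \<Longrightarrow> (\<And>x. wf_trm ar (\<sigma> x))
    \<Longrightarrow> derivable ar T (subst \<sigma> s) (subst \<sigma> t)"

definition is_algebra :: "('f \<Rightarrow> nat) \<Rightarrow> 'f eqs \<Rightarrow> 'a set \<Rightarrow> ('f \<Rightarrow> 'a list \<Rightarrow> 'a) \<Rightarrow> bool" where
  "is_algebra ar T A I \<longleftrightarrow>
     (\<forall>f as. length as = ar f \<longrightarrow> set as \<subseteq> A \<longrightarrow> I f as \<in> A) \<and>
     (\<forall>(s, t) \<in> T. \<forall>\<alpha>. range \<alpha> \<subseteq> A \<longrightarrow> eval I \<alpha> s = eval I \<alpha> t)"

definition pointed_wrt :: "('f \<Rightarrow> nat) \<Rightarrow> 'f eqs \<Rightarrow> 'f \<Rightarrow> bool" where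
  "pointed_wrt ar T c \<longleftrightarrow>
     ar c = 0 \<and> (\<forall>f. derivable ar T (Fun f (replicate (ar f) (Fun c []))) (Fun c []))"

definition pointed :: "('f \<Rightarrow> nat) \<Rightarrow> 'f eqs \<Rightarrow> bool" where
  "pointed ar T \<longleftrightarrow> (\<exists>c. pointed_wrt ar T c)"

text \<open>The term \<open>\<theta>(x\<^sub>0, \<dots>, x\<^sub>n)\<close> uses the variables \<open>0, \<dots>, n\<close>, and in each binary term
  \<open>\<theta>\<^sub>i(x, y)\<close> the variables \<open>0\<close> and \<open>1\<close> stand for \<open>x\<close> and \<open>y\<close>.
  Constant terms are terms without variables.\<close>

definition protomodular :: "('f \<Rightarrow> nat) \<Rightarrow> 'f eqs \<Rightarrow> bool" where
  "protomodular ar T \<longleftrightarrow>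
     (\<exists>(n :: nat) (\<theta> :: ('f, nat) trm) (\<theta>s :: nat \<Rightarrow> ('f, nat) trm).
        wf_trm ar \<theta> \<and> vars \<theta> \<subseteq> {0..n} \<and>
        (\<forall>i \<in> {1..n}. wf_trm ar (\<theta>s i) \<and> vars (\<theta>s i) \<subseteq> {0, 1}) \<and>
        (\<forall>i \<in> {1..n}. \<exists>c :: ('f, nat) trm. wf_trm ar c \<and> vars c = {} \<and>
           derivable ar T (subst (\<lambda>_. Var 0) (\<theta>s i)) c) \<and>
        derivable ar T (subst (\<lambda>i. if i = 0 then Var 1 else \<theta>s i) \<theta>) (Var 0))"

definition semi_abelian :: "('f \<Rightarrow> nat) \<Rightarrow> 'f eqs \<Rightarrow> bool" where
  "semi_abelian ar T \<longleftrightarrow> is_theory ar T \<and> pointed ar T \<and> protomodular ar T"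


datatype j_op = Star | Imp | E

fun j_arity :: "j_op \<Rightarrow> nat" where
  "j_arity Star = 2"
| "j_arity Imp = 2"
| "j_arity E = 0"

type_synonym j_trm = "(j_op, nat) trm"

abbreviation j_star :: "j_trm \<Rightarrow> j_trm \<Rightarrow> j_trm" (infixl "\<^bold>*" 70) where
  "s \<^bold>* t \<equiv> Fun Star [s, t]"

abbreviation j_imp :: "j_trm \<Rightarrow> j_trm \<Rightarrow> j_trm" (infixr "\<^bold>\<rightarrow>" 65) where
  "s \<^bold>\<rightarrow> t \<equiv> Fun Imp [s, t]"

abbreviation j_e :: j_trm ("\<^bold>e") where
  "\<^bold>e \<equiv> Fun E []"

abbreviation j_x :: j_trm ("\<^bold>x") where
  "\<^bold>x \<equiv> Var 0"

abbreviation j_y :: j_trm ("\<^bold>y") where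
  "\<^bold>y \<equiv> Var 1"

definition J :: "j_op eqs" where
  "J = {(\<^bold>x \<^bold>\<rightarrow> \<^bold>x, \<^bold>e),
        (\<^bold>e \<^bold>\<rightarrow> \<^bold>x, \<^bold>x),
        (((\<^bold>x \<^bold>\<rightarrow> \<^bold>y) \<^bold>\<rightarrow> \<^bold>y) \<^bold>* (((\<^bold>x \<^bold>\<rightarrow> \<^bold>y) \<^bold>\<rightarrow> \<^bold>y) \<^bold>\<rightarrow> \<^bold>x), \<^bold>x)}"

abbreviation j_derives :: "j_op eqs \<Rightarrow> j_trm \<Rightarrow> j_trm \<Rightarrow> bool" ("_ \<turnstile> _ \<approx> _" [51, 51, 51] 50) where
  "T \<turnstile> s \<approx> t \<equiv> derivable j_arity T s t"

definition theta :: "j_trm \<Rightarrow> j_trm \<Rightarrow> j_trm \<Rightarrow> j_trm" where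
  "theta x0 x1 x2 = (x1 \<^bold>\<rightarrow> x0) \<^bold>* x2"

definition theta1 :: "j_trm \<Rightarrow> j_trm \<Rightarrow> j_trm" where
  "theta1 x y = x \<^bold>\<rightarrow> y"

definition theta2 :: "j_trm \<Rightarrow> j_trm \<Rightarrow> j_trm" where
  "theta2 x y = ((x \<^bold>\<rightarrow> y) \<^bold>\<rightarrow> y) \<^bold>\<rightarrow> x"

definition le_alg :: "(j_op \<Rightarrow> 'a list \<Rightarrow> 'a) \<Rightarrow> 'a \<Rightarrow> 'a \<Rightarrow> bool" where
  "le_alg I a b \<longleftrightarrow> I Imp [a, b] = I E []"

end

(* The third axiom is the protomodularity equation \<theta>(y, \<theta>\<^sub>1(x, y), \<theta>\<^sub>2(x, y)) \<approx> x written out.  For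
   y = x the first two axioms collapse its left-hand side to x * e, so e is a right unit.
   In an algebra, a \<le> b turns the axiom into b * (b \<rightarrow> a) = a; if also b \<le> a, then
   a = b * e = b. *)

theory Submission
  imports Defs
begin

declare derivable.trans [trans]

lemma derivable_cong2:
  assumes "ar f = 2" and "derivable ar T s s'" and "derivable ar T t t'"
  shows "derivable ar T (Fun f [s, t]) (Fun f [s', t'])"
  by (rule derivable.cong) (use assms in simp_all)

lemma derivable_axiom_instance:
  assumes "(s, t) \<in> T" and "\<And>x. wf_trm ar (\<sigma> x)"
  shows "derivable ar T (subst \<sigma> s) (subst \<sigma> t)"
  using assms by (intro derivable.inst derivable.ax)

lemma eval_subst: "eval I \<alpha> (subst \<sigma> t) = eval I (\<lambda>x. eval I \<alpha> (\<sigma> x)) t"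
  by (induction t) (simp_all cong: map_cong)

lemma eval_in_algebra:
  assumes "is_algebra ar T A I" and "range \<alpha> \<subseteq> A" and "wf_trm ar t"
  shows "eval I \<alpha> t \<in> A"
  using assms(3)
proof (induction t)
  case (Var x)
  then show ?case using assms(2) by auto
next
  case (Fun f ts)
  then have "length (map (eval I \<alpha>) ts) = ar f" and "set (map (eval I \<alpha>) ts) \<subseteq> A"
    by auto
  then show ?case using assms(1) by (simp add: is_algebra_def)
qed

lemma derivable_sound:
  assumes "derivable ar T s t" and alg: "is_algebra ar T A I" and "range \<alpha> \<subseteq> A"
  shows "eval I \<alpha> s = eval I \<alpha> t"
  using assms(1,3)
proof (induction arbitrary: \<alpha> rule: derivable.induct)
  case (ax s t)
  then show ?case using alg by (fastforce simp: is_algebra_def)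
next
  case (cong ss f ts)
  then have "map (eval I \<alpha>) ss = map (eval I \<alpha>) ts"
    by (auto simp: list_all2_conv_all_nth intro: nth_equalityI)
  then show ?case by (metis eval.simps(2))
next
  case (inst s t \<sigma>)
  then have "range (\<lambda>x. eval I \<alpha> (\<sigma> x)) \<subseteq> A"
    using eval_in_algebra[OF alg] by blast
  then show ?case using inst.IH by (simp add: eval_subst)
qed simp_all

lemma J_imp_self:
  assumes "wf_trm j_arity s"
  shows "J \<turnstile> s \<^bold>\<rightarrow> s \<approx> \<^bold>e"
  using derivable_axiom_instance[of "\<^bold>x \<^bold>\<rightarrow> \<^bold>x" "\<^bold>e" J j_arity "\<lambda>_. s"] assms
  by (simp add: J_def)

lemma J_e_imp:
  assumes "wf_trm j_arity s"
  shows "J \<turnstile> \<^bold>e \<^bold>\<rightarrow> s \<approx> s"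
  using derivable_axiom_instance[of "\<^bold>e \<^bold>\<rightarrow> \<^bold>x" "\<^bold>x" J j_arity "\<lambda>_. s"] assms
  by (simp add: J_def)

lemma J_theta_decomposition:
  assumes "wf_trm j_arity s" and "wf_trm j_arity t"
  shows "J \<turnstile> theta t (theta1 s t) (theta2 s t) \<approx> s"
  using derivable_axiom_instance[of "theta \<^bold>y (theta1 \<^bold>x \<^bold>y) (theta2 \<^bold>x \<^bold>y)" "\<^bold>x" J j_arity
      "\<lambda>i. if i = 0 then s else t"] assms
  by (simp add: J_def theta_def theta1_def theta2_def)

lemma J_theta1_self:
  assumes "wf_trm j_arity s"
  shows "J \<turnstile> theta1 s s \<approx> \<^bold>e"
  unfolding theta1_def using assms by (rule J_imp_self)

lemma J_imp_self_imp:
  assumes "wf_trm j_arity s" and "wf_trm j_arity t"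
  shows "J \<turnstile> (s \<^bold>\<rightarrow> s) \<^bold>\<rightarrow> t \<approx> t"
proof -
  have "J \<turnstile> (s \<^bold>\<rightarrow> s) \<^bold>\<rightarrow> t \<approx> \<^bold>e \<^bold>\<rightarrow> t"
    using assms by (intro derivable_cong2 J_imp_self derivable.refl) simp_all
  also have "J \<turnstile> \<^bold>e \<^bold>\<rightarrow> t \<approx> t"
    using assms(2) by (rule J_e_imp)
  finally show ?thesis .
qed

lemma J_theta2_self:
  assumes "wf_trm j_arity s"
  shows "J \<turnstile> theta2 s s \<approx> \<^bold>e"
proof -
  have "J \<turnstile> theta2 s s \<approx> s \<^bold>\<rightarrow> s"
    unfolding theta2_def
    using assms by (intro derivable_cong2 J_imp_self_imp derivable.refl) simp_all
  also have "J \<turnstile> s \<^bold>\<rightarrow> s \<approx> \<^bold>e"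
    using assms by (rule J_imp_self)
  finally show ?thesis .
qed

lemma J_star_e:
  assumes "wf_trm j_arity s"
  shows "J \<turnstile> s \<^bold>* \<^bold>e \<approx> s"
proof -
  have "J \<turnstile> theta s (theta1 s s) (theta2 s s) \<approx> s \<^bold>* \<^bold>e"
    unfolding theta_def theta1_def
    using assms by (intro derivable_cong2 J_imp_self_imp J_theta2_self) simp_all
  then have "J \<turnstile> s \<^bold>* \<^bold>e \<approx> theta s (theta1 s s) (theta2 s s)"
    by (rule derivable.sym)
  also have "J \<turnstile> theta s (theta1 s s) (theta2 s s) \<approx> s"
    using assms assms by (rule J_theta_decomposition)
  finally show ?thesis .
qed

lemma is_theory_J: "is_theory j_arity J"
  by (auto simp: is_theory_def J_def)

lemma pointed_wrt_J: "pointed_wrt j_arity J E"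
  unfolding pointed_wrt_def
proof (intro conjI allI)
  fix f
  show "J \<turnstile> Fun f (replicate (j_arity f) \<^bold>e) \<approx> \<^bold>e"
  proof (cases f)
    case Star
    then show ?thesis using J_star_e[of "\<^bold>e"] by (simp add: numeral_2_eq_2)
  next
    case Imp
    then show ?thesis using J_imp_self[of "\<^bold>e"] by (simp add: numeral_2_eq_2)
  next
    case E
    then show ?thesis by (simp add: derivable.refl)
  qed
qed simp

lemma protomodular_J: "protomodular j_arity J"
proof -
  let ?\<theta> = "theta (Var 0) (Var 1) (Var 2)"
  let ?\<theta>s = "\<lambda>i::nat. if i = 1 then theta1 \<^bold>x \<^bold>y else theta2 \<^bold>x \<^bold>y"
  show ?thesis
    unfolding protomodular_def
  proof (rule exI[of _ 2], rule exI[of _ ?\<theta>], rule exI[of _ ?\<theta>s], intro conjI ballI)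
    show "wf_trm j_arity ?\<theta>" and "vars ?\<theta> \<subseteq> {0..2}"
      by (auto simp: theta_def)
    show "wf_trm j_arity (?\<theta>s i)" and "vars (?\<theta>s i) \<subseteq> {0, 1}" for i
      by (auto simp: theta1_def theta2_def)
    show "\<exists>c :: j_trm. wf_trm j_arity c \<and> vars c = {} \<and> J \<turnstile> subst (\<lambda>_. \<^bold>x) (?\<theta>s i) \<approx> c" for i
    proof (intro exI[of _ "\<^bold>e"] conjI)
      show "J \<turnstile> subst (\<lambda>_. \<^bold>x) (?\<theta>s i) \<approx> \<^bold>e"
        using J_theta1_self[of "\<^bold>x"] J_theta2_self[of "\<^bold>x"] by (simp add: theta1_def theta2_def)
    qed simp_all
    show "J \<turnstile> subst (\<lambda>i. if i = 0 then \<^bold>y else ?\<theta>s i) ?\<theta> \<approx> \<^bold>x"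
      using J_theta_decomposition[of "\<^bold>x" "\<^bold>y"] by (simp add: theta_def)
  qed
qed

lemma semi_abelian_J: "semi_abelian j_arity J"
  unfolding semi_abelian_def pointed_def
  using is_theory_J pointed_wrt_J protomodular_J by blast

context
  fixes A :: "'a set" and I
  assumes alg: "is_algebra j_arity J A I"
begin

lemma algebra_imp_self:
  assumes "a \<in> A"
  shows "I Imp [a, a] = I E []"
  using derivable_sound[OF J_imp_self[of "\<^bold>x"] alg, of "\<lambda>_. a"] assms by simp

lemma algebra_e_imp:
  assumes "a \<in> A"
  shows "I Imp [I E [], a] = a"
  using derivable_sound[OF J_e_imp[of "\<^bold>x"] alg, of "\<lambda>_. a"] assms by simp

lemma algebra_star_e:
  assumes "a \<in> A"
  shows "I Star [a, I E []] = a"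
  using derivable_sound[OF J_star_e[of "\<^bold>x"] alg, of "\<lambda>_. a"] assms by simp

lemma algebra_theta_decomposition:
  assumes "a \<in> A" and "b \<in> A"
  shows "I Star [I Imp [I Imp [a, b], b], I Imp [I Imp [I Imp [a, b], b], a]] = a"
  using derivable_sound[OF J_theta_decomposition[of "\<^bold>x" "\<^bold>y"] alg,
      of "\<lambda>i. if i = 0 then a else b"] assms
  by (auto simp: theta_def theta1_def theta2_def)

lemma le_alg_imp_imp:
  assumes "b \<in> A" and "le_alg I a b"
  shows "I Imp [I Imp [a, b], b] = b"
  using assms by (simp add: le_alg_def algebra_e_imp)

lemma le_alg_star_imp:
  assumes "a \<in> A" and "b \<in> A" and "le_alg I a b"
  shows "I Star [b, I Imp [b, a]] = a"
  using algebra_theta_decomposition[of a b] assms by (simp add: le_alg_imp_imp)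

lemma reflp_on_le_alg: "reflp_on A (le_alg I)"
  by (rule reflp_onI) (simp add: le_alg_def algebra_imp_self)

lemma antisymp_on_le_alg: "antisymp_on A (le_alg I)"
proof (rule antisymp_onI)
  fix a b
  assume "a \<in> A" "b \<in> A" "le_alg I a b" "le_alg I b a"
  then have "a = I Star [b, I Imp [b, a]]"
    by (simp add: le_alg_star_imp)
  also have "\<dots> = I Star [b, I E []]"
    using \<open>le_alg I b a\<close> by (simp add: le_alg_def)
  also have "\<dots> = b"
    using \<open>b \<in> A\<close> by (rule algebra_star_e)
  finally show "a = b" .
qed

end

theorem mainTheorem6:
  shows "(semi_abelian j_arity J \<and>
      pointed_wrt j_arity J E \<and>
      J \<turnstile> \<^bold>e \<^bold>\<rightarrow> \<^bold>e \<approx> \<^bold>e \<and>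
      J \<turnstile> \<^bold>e \<^bold>* \<^bold>e \<approx> \<^bold>e \<and>
      J \<turnstile> \<^bold>x \<^bold>* \<^bold>e \<approx> \<^bold>x \<and>
      J \<turnstile> theta1 \<^bold>x \<^bold>x \<approx> \<^bold>e \<and>
      J \<turnstile> theta2 \<^bold>x \<^bold>x \<approx> \<^bold>e \<and>
      J \<turnstile> theta \<^bold>y (theta1 \<^bold>x \<^bold>y) (theta2 \<^bold>x \<^bold>y) \<approx> \<^bold>x) \<and>
    (\<forall>(A :: 'a set) I. is_algebra j_arity J A I \<longrightarrow>
      reflp_on A (le_alg I) \<and>
      antisymp_on A (le_alg I) \<and>
      (\<forall>a \<in> A. \<forall>b \<in> A. le_alg I a b \<longrightarrow> I Imp [I Imp [a, b], b] = b))"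
proof (intro conjI allI impI ballI)
  show "semi_abelian j_arity J" by (fact semi_abelian_J)
  show "pointed_wrt j_arity J E" by (fact pointed_wrt_J)
  show "J \<turnstile> \<^bold>e \<^bold>\<rightarrow> \<^bold>e \<approx> \<^bold>e" by (simp add: J_imp_self)
  show "J \<turnstile> \<^bold>e \<^bold>* \<^bold>e \<approx> \<^bold>e" and "J \<turnstile> \<^bold>x \<^bold>* \<^bold>e \<approx> \<^bold>x" by (simp_all add: J_star_e)
  show "J \<turnstile> theta1 \<^bold>x \<^bold>x \<approx> \<^bold>e" by (simp add: J_theta1_self)
  show "J \<turnstile> theta2 \<^bold>x \<^bold>x \<approx> \<^bold>e" by (simp add: J_theta2_self)
  show "J \<turnstile> theta \<^bold>y (theta1 \<^bold>x \<^bold>y) (theta2 \<^bold>x \<^bold>y) \<approx> \<^bold>x" by (simp add: J_theta_decomposition)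
next
  fix A :: "'a set" and I
  assume alg: "is_algebra j_arity J A I"
  show "reflp_on A (le_alg I)" by (rule reflp_on_le_alg[OF alg])
  show "antisymp_on A (le_alg I)" by (rule antisymp_on_le_alg[OF alg])
  show "I Imp [I Imp [a, b], b] = b" if "b \<in> A" and "le_alg I a b" for a b
    using that by (rule le_alg_imp_imp[OF alg])
qed

end
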